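(* Let $\mathbb{B}$ be a complete Boolean algebra. For a set $F\subset\mathbb{B}$ the following conditions are equivalent: (a) $F$ is closed in the space $\langle\mathbb{B},\mathcal{O}^\uparrow\rangle$; (b) $F$ is upward closed and closed with respect to the $\limsup$ operator (that is, $\limsup x\in F$ for every sequence $x$ in $F$); (c) $F$ is upward closed and for each decreasing sequence $x=\langle x_n:n\in\omega\rangle$ in $F$ we have $\bigwedge_{n\in\omega}x_n\in F$ ($F$ is $\omega_1$-closed).
   Context: For a sequence $x=\langle x_n:n\in\omega\rangle$ in a complete Boolean algebra $\mathbb{B}$, $\limsup x=\bigwedge_{k\in\omega}\bigvee_{n\ge k}x_n$. The topology $\mathcal{O}^\uparrow$ on $\mathbb{B}$ is the topology generated by the convergence $x\mapsto\{\limsup x\}$: a set $O\subset\mathbb{B}$ is open iff for every sequence $x$ in $\mathbb{B}$ with $\limsup x\in O$ there is $n_0\in\omega$ such that $x_n\in O$ for all $n\ge n_0$. A set $F$ is upward closed iff $F=F\uparrow$, where $F\uparrow=\{b\in\mathbb{B}:\exists a\in F\ a\le b\}$. A sequence is decreasing iff $x_n\ge x_m$ whenever $n\le m$. *)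

theory Defs
  imports "HOL-Analysis.Abstract_Topology" "HOL-Library.Liminf_Limsup"
begin

text \<open>
  A complete Boolean algebra is a type of sort \<open>{boolean_algebra, complete_lattice}\<close>. The library
  class \<open>complete_boolean_algebra\<close> is not used, because it also assumes complete distributivity
  (which forces the algebra to be atomic, i.e. a power set algebra).

  The lemma \<open>limsup_INF_SUP\<close> shows that the library's \<open>limsup\<close> is the required lattice expression.
\<close>

definition limsup_open :: "'a::{boolean_algebra, complete_lattice} set \<Rightarrow> bool" where
  "limsup_open U \<longleftrightarrow>
     (\<forall>x :: nat \<Rightarrow> 'a. limsup x \<in> U \<longrightarrow> (\<exists>n0. \<forall>n\<ge>n0. x n \<in> U))"

lemma istopology_limsup_open: "istopology limsup_open"
  unfolding istopology_def
proof (intro conjI allI impI)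
  fix S T :: "'a set"
  assume S: "limsup_open S" and T: "limsup_open T"
  show "limsup_open (S \<inter> T)"
    unfolding limsup_open_def
  proof (intro allI impI)
    fix x :: "nat \<Rightarrow> 'a"
    assume x: "limsup x \<in> S \<inter> T"
    obtain m where m: "\<forall>n\<ge>m. x n \<in> S" using S x unfolding limsup_open_def by blast
    obtain k where k: "\<forall>n\<ge>k. x n \<in> T" using T x unfolding limsup_open_def by blast
    from m k have "\<forall>n\<ge>max m k. x n \<in> S \<inter> T" by simp
    then show "\<exists>n0. \<forall>n\<ge>n0. x n \<in> S \<inter> T" by blast
  qed
next
  fix \<K> :: "'a set set"
  assume "\<forall>K\<in>\<K>. limsup_open K"
  then show "limsup_open (\<Union>\<K>)"
    unfolding limsup_open_def by (meson Union_iff)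
qed

definition limsup_topology :: "'a::{boolean_algebra, complete_lattice} topology" where
  "limsup_topology = topology limsup_open"

lemma openin_limsup_topology [simp]: "openin limsup_topology = limsup_open"
  by (simp add: limsup_topology_def istopology_limsup_open topology_inverse')

lemma topspace_limsup_topology [simp]: "topspace limsup_topology = UNIV"
  by (auto simp: topspace_def limsup_open_def intro!: exI[of _ UNIV])

definition up_closure :: "'a::order set \<Rightarrow> 'a set" where
  "up_closure F = {b. \<exists>a\<in>F. a \<le> b}"

definition upward_closed :: "'a::order set \<Rightarrow> bool" where
  "upward_closed F \<longleftrightarrow> F = up_closure F"

definition limsup_closed :: "'a::{boolean_algebra, complete_lattice} set \<Rightarrow> bool" where
  "limsup_closed F \<longleftrightarrow> (\<forall>x :: nat \<Rightarrow> 'a. (\<forall>n. x n \<in> F) \<longrightarrow> limsup x \<in> F)"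

definition omega1_closed :: "'a::{boolean_algebra, complete_lattice} set \<Rightarrow> bool" where
  "omega1_closed F \<longleftrightarrow>
     (\<forall>x :: nat \<Rightarrow> 'a. decseq x \<and> (\<forall>n. x n \<in> F) \<longrightarrow> (INF n. x n) \<in> F)"

end

theory Submission
  imports Defs
begin

text \<open>
  Closedness says: if \<open>x\<close> visits \<open>F\<close> infinitely often, then \<open>limsup x \<in> F\<close>. If \<open>F\<close> is upward
  closed, all the tail suprema of such an \<open>x\<close> lie in \<open>F\<close>, and \<open>limsup x\<close> is the infimum of this
  decreasing sequence. Conversely, upward closure is seen from the sequence \<open>a, b, a, b, \<dots>\<close> with
  \<open>a \<le> b\<close>, whose limit superior is \<open>b\<close>.
\<close>

text \<open>The first term of each tail is its largest, hence its supremum.\<close>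

lemma limsup_decseq:
  fixes x :: "nat \<Rightarrow> 'a::complete_lattice"
  assumes "decseq x"
  shows "limsup x = (INF n. x n)"
proof -
  have "(SUP m\<in>{n..}. x m) = x n" for n
    using assms by (intro antisym SUP_least SUP_upper) (auto dest: decseqD)
  then show ?thesis
    by (simp add: limsup_INF_SUP)
qed

lemma limsup_alternating:
  fixes a b :: "'a::complete_lattice"
  assumes "a \<le> b"
  shows "limsup (\<lambda>n. if even n then a else b) = b"
proof -
  have "(SUP m\<in>{n..}. if even m then a else b) = b" for n :: nat
    \<comment> \<open>The odd index \<open>2 * n + 1\<close> lies in the tail from \<open>n\<close>,
      so the bound \<open>b\<close> is attained there.\<close>
    using assms by (intro antisym SUP_least SUP_upper2[of "2 * n + 1"]) auto
  then show ?thesis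
    by (simp add: limsup_INF_SUP)
qed

lemma upward_closed_iff: "upward_closed F \<longleftrightarrow> (\<forall>a\<in>F. \<forall>b. a \<le> b \<longrightarrow> b \<in> F)"
  by (auto simp: upward_closed_def up_closure_def)

text \<open>Openness of the complement, read contrapositively: failing to stay eventually outside
  \<open>F\<close> means visiting \<open>F\<close> infinitely often.\<close>

lemma closedin_limsup_topology_iff:
  "closedin limsup_topology F \<longleftrightarrow>
     (\<forall>x :: nat \<Rightarrow> _. (\<exists>\<^sub>F n in sequentially. x n \<in> F) \<longrightarrow> limsup x \<in> F)"
  unfolding frequently_sequentially closedin_def by (simp add: limsup_open_def) meson

lemma upward_closed_if_closedin:
  assumes "closedin limsup_topology F"
  shows "upward_closed F"
  unfolding upward_closed_iff
proof (intro ballI allI impI)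
  fix a b
  assume "a \<in> F" "a \<le> b"
  define x where "x = (\<lambda>n :: nat. if even n then a else b)"
  have "\<exists>\<^sub>F n in sequentially. x n \<in> F"
    unfolding frequently_sequentially
  proof
    fix N :: nat
    show "\<exists>n\<ge>N. x n \<in> F"
      \<comment> \<open>\<open>2 * N\<close> is an even index not below \<open>N\<close>, so
        \<open>x\<close> takes the value \<open>a\<close> there.\<close>
      using \<open>a \<in> F\<close> by (intro exI[of _ "2 * N"]) (simp add: x_def)
  qed
  with assms have "limsup x \<in> F"
    unfolding closedin_limsup_topology_iff by blast
  with \<open>a \<le> b\<close> show "b \<in> F"
    by (simp add: x_def limsup_alternating)
qed

lemma limsup_closed_if_closedin: "closedin limsup_topology F \<Longrightarrow> limsup_closed F"
  by (auto simp: closedin_limsup_topology_iff limsup_closed_def frequently_sequentially)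

lemma omega1_closed_if_limsup_closed: "limsup_closed F \<Longrightarrow> omega1_closed F"
  unfolding limsup_closed_def omega1_closed_def by (metis limsup_decseq)

lemma closedin_if_omega1_closed:
  assumes "upward_closed F" "omega1_closed F"
  shows "closedin limsup_topology F"
  unfolding closedin_limsup_topology_iff
proof (intro allI impI)
  fix x :: "nat \<Rightarrow> 'a"
  assume freq: "\<exists>\<^sub>F n in sequentially. x n \<in> F"
  have "(SUP m\<in>{n..}. x m) \<in> F" for n
  proof -
    obtain m where "m \<ge> n" "x m \<in> F"
      using freq by (auto simp: frequently_sequentially)
    moreover from \<open>m \<ge> n\<close> have "x m \<le> (SUP m\<in>{n..}. x m)"
      by (intro SUP_upper) simp
    ultimately show ?thesis
      using assms(1) unfolding upward_closed_iff by blast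
  qed
  \<comment> \<open>Later tails are subsets of earlier ones, so their suprema decrease.\<close>
  moreover have "decseq (\<lambda>n. SUP m\<in>{n..}. x m)"
    by (intro decseq_SucI SUP_subset_mono) auto
  ultimately show "limsup x \<in> F"
    using assms(2) unfolding omega1_closed_def limsup_INF_SUP by blast
qed

theorem theorem4p1:
  fixes F :: "'a::{boolean_algebra, complete_lattice} set"
  shows "(closedin limsup_topology F \<longleftrightarrow> upward_closed F \<and> limsup_closed F) \<and>
         (upward_closed F \<and> limsup_closed F \<longleftrightarrow> upward_closed F \<and> omega1_closed F)"
  using upward_closed_if_closedin limsup_closed_if_closedin omega1_closed_if_limsup_closed
    closedin_if_omega1_closed by blast

end
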